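(* Let $\mathcal{T}_{\mathrm{Sch}}$ be the generating tree of the succession rule (NewSch): the root is labelled $(1,1)$, and a vertex labelled $(h,k)$ has children labelled $$(1,k+1),\ldots,(h,k+1),\ (2,1),\ldots,(2,k-1),\ (h+1,k).$$ Let $\mathcal{T}_{\mathrm{Bax}}$ be the generating tree of the succession rule (Bax): the root is labelled $(1,1)$, and a vertex labelled $(h,k)$ has children labelled $$(1,k+1),\ldots,(h,k+1),\ (h+1,1),\ldots,(h+1,k).$$ Then $\mathcal{T}_{\mathrm{Sch}}$ is isomorphic to a subtree of $\mathcal{T}_{\mathrm{Bax}}$. That is, there is an injective map from the vertices of $\mathcal{T}_{\mathrm{Sch}}$ to the vertices of $\mathcal{T}_{\mathrm{Bax}}$ that sends the root to the root and sends children of any vertex to children of its image.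
   Context: A succession rule consists of a root label and, for each label, a list of the labels of its children. It determines an infinite rooted labelled tree: the root is at depth $1$ and every vertex with label $\lambda$ has one child for each label in the production of $\lambda$. *)

theory Defs
  imports Main
begin

record 'l succession_rule =
  root_label :: 'l
  production :: "'l \<Rightarrow> 'l list"

text \<open>
  A vertex of the generating tree is encoded by the list of child positions leading to it from
  the root, so distinct children of a vertex stay distinct even when their labels coincide.
  The root is the empty list, and a vertex \<open>v\<close> is at depth \<open>length v + 1\<close>.
  The value of \<open>label_of\<close> is only meaningful on \<open>vertices\<close>.
\<close>

definition label_of :: "'l succession_rule \<Rightarrow> nat list \<Rightarrow> 'l" where
  "label_of R v = foldl (\<lambda>l i. production R l ! i) (root_label R) v"

definition children :: "'l succession_rule \<Rightarrow> nat list \<Rightarrow> nat list set" where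
  "children R v = {v @ [i] | i. i < length (production R (label_of R v))}"

inductive_set vertices :: "'l succession_rule \<Rightarrow> nat list set" for R where
  root: "[] \<in> vertices R"
| child: "v \<in> vertices R \<Longrightarrow> w \<in> children R v \<Longrightarrow> w \<in> vertices R"

text \<open>The image of such a map is a subtree of the second tree containing its root.\<close>

definition tree_embedding ::
  "'l succession_rule \<Rightarrow> 'm succession_rule \<Rightarrow> (nat list \<Rightarrow> nat list) \<Rightarrow> bool" where
  "tree_embedding R S f \<longleftrightarrow>
     f ` vertices R \<subseteq> vertices S \<and> inj_on f (vertices R) \<and> f [] = [] \<and>
     (\<forall>v\<in>vertices R. \<forall>w\<in>children R v. f w \<in> children S (f v))"

definition isomorphic_to_subtree :: "'l succession_rule \<Rightarrow> 'm succession_rule \<Rightarrow> bool" where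
  "isomorphic_to_subtree R S \<longleftrightarrow> (\<exists>f. tree_embedding R S f)"

text \<open>All labels occurring in the two trees below have positive components.\<close>

definition NewSch :: "(nat \<times> nat) succession_rule" where
  "NewSch = \<lparr> root_label = (1, 1),
     production = (\<lambda>(h, k). map (\<lambda>i. (i, k + 1)) [1..<h + 1] @ map (\<lambda>j. (2, j)) [1..<k] @ [(h + 1, k)]) \<rparr>"

definition Bax :: "(nat \<times> nat) succession_rule" where
  "Bax = \<lparr> root_label = (1, 1),
     production = (\<lambda>(h, k). map (\<lambda>i. (i, k + 1)) [1..<h + 1] @ map (\<lambda>j. (h + 1, j)) [1..<k + 1]) \<rparr>"

end

theory Submission imports Defs
begin

text \<open>
  A Bax vertex whose label dominates a NewSch label componentwise has children whose labels
  dominate those of the NewSch vertex: \<open>(i, k + 1)\<close> is matched with \<open>(i, k' + 1)\<close>,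
  \<open>(2, j)\<close> with \<open>(h' + 1, j)\<close>, and \<open>(h + 1, k)\<close> with \<open>(h' + 1, k)\<close>. Hence the
  identification of the roots extends level by level.
\<close>

lemma label_of_Nil [simp]: "label_of R [] = root_label R"
  by (simp add: label_of_def)

lemma label_of_snoc [simp]: "label_of R (v @ [i]) = production R (label_of R v) ! i"
  by (simp add: label_of_def)

text \<open>Paths are reversed here, so that the recursion follows the tree downwards from the root.\<close>

primrec translate_rev ::
  "'l succession_rule \<Rightarrow> 'm succession_rule \<Rightarrow> ('l \<Rightarrow> 'm \<Rightarrow> nat \<Rightarrow> nat) \<Rightarrow> nat list \<Rightarrow> nat list" where
  "translate_rev R S g [] = []"
| "translate_rev R S g (i # u) =
     translate_rev R S g u @
       [g (label_of R (rev u)) (label_of S (translate_rev R S g u)) i]"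

text \<open>Everything is local: \<open>g l m\<close> chooses positions for the children at a pair
  of related labels, and \<open>step\<close> keeps the pairs related along edges. Injectivity among
  siblings suffices because an image path contains the images of all ancestors as prefixes.\<close>

lemma isomorphic_to_subtree_if_simulation:
  fixes R :: "'l succession_rule" and S :: "'m succession_rule"
  assumes root: "sim (root_label R) (root_label S)"
    and inj: "\<And>l m. sim l m \<Longrightarrow> inj_on (g l m) {..<length (production R l)}"
    and bound: "\<And>l m i. sim l m \<Longrightarrow> i < length (production R l) \<Longrightarrow>
      g l m i < length (production S m)"
    and step: "\<And>l m i. sim l m \<Longrightarrow> i < length (production R l) \<Longrightarrow>
      sim (production R l ! i) (production S m ! g l m i)"
  shows "isomorphic_to_subtree R S"
proof -
  define f where "f v = translate_rev R S g (rev v)" for v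
  have f_Nil [simp]: "f [] = []"
    by (simp add: f_def)
  have f_snoc [simp]: "f (v @ [i]) = f v @ [g (label_of R v) (label_of S (f v)) i]" for v i
    by (simp add: f_def)
  \<comment> \<open>Extending \<open>f v\<close> by a legal child position relies on
    \<open>bound\<close>, which applies only to related labels.\<close>
  have sim: "f v \<in> vertices S \<and> sim (label_of R v) (label_of S (f v))"
    if "v \<in> vertices R" for v
    using that
  proof induction
    case root
    show ?case
      using assms(1) by (simp add: vertices.root)
  next
    case (child v w)
    then obtain i where "w = v @ [i]" "i < length (production R (label_of R v))"
      by (auto simp: children_def)
    with child.IH bound step show ?case
      by (auto simp: children_def intro!: vertices.child[of "f v"])
  qed
  \<comment> \<open>Equal images have equal parent images, so the parents agree by induction; then
    both last positions pass through the same injective \<open>g l m\<close>.\<close>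
  have "v = w" if "v \<in> vertices R" "w \<in> vertices R" "f v = f w" for v w
    using that
  proof (induction arbitrary: w)
    case root
    from root.prems show ?case
      by cases (auto simp: children_def)
  next
    case (child v v')
    from child.hyps obtain i where v': "v' = v @ [i]" "i < length (production R (label_of R v))"
      by (auto simp: children_def)
    from child.prems(1) show ?case
    proof cases
      case root
      with child.prems v' show ?thesis by simp
    next
      case (child u)
      then obtain j where w: "w = u @ [j]" "j < length (production R (label_of R u))"
        by (auto simp: children_def)
      with v' \<open>f v' = f w\<close> child have "v = u"
        by (intro "child.IH") auto
      with v' w \<open>f v' = f w\<close> inj_onD[OF inj] sim[OF \<open>u \<in> vertices R\<close>] show ?thesis
        by auto
    qed
  qed
  then have "inj_on f (vertices R)"
    by (auto intro: inj_onI)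
  moreover have "f w \<in> children S (f v)" if "v \<in> vertices R" "w \<in> children R v" for v w
    using that sim bound by (auto simp: children_def)
  ultimately have "tree_embedding R S f"
    using sim by (auto simp: tree_embedding_def)
  then show ?thesis
    by (auto simp: isomorphic_to_subtree_def)
qed

lemma length_production_NewSch:
  "1 \<le> k \<Longrightarrow> length (production NewSch (h, k)) = h + k"
  by (simp add: NewSch_def)

lemma nth_production_NewSch:
  assumes "1 \<le> k" "i < h + k"
  shows "production NewSch (h, k) ! i =
    (if i < h then (i + 1, k + 1) else if i < h + k - 1 then (2, i - h + 1) else (h + 1, k))"
proof -
  \<comment> \<open>This is the index into the singleton \<open>[(h + 1, k)]\<close> once the first
    two blocks, of lengths \<open>h\<close> and \<open>k - 1\<close>, are skipped.\<close>
  have "i - h - (k - 1) = 0"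
    using assms by simp
  with assms show ?thesis
    by (auto simp: NewSch_def nth_append simp del: upt_Suc)
qed

lemma length_production_Bax: "length (production Bax (h, k)) = h + k"
  by (simp add: Bax_def)

lemma nth_production_Bax:
  "i < h + k \<Longrightarrow> production Bax (h, k) ! i =
    (if i < h then (i + 1, k + 1) else (h + 1, i - h + 1))"
  by (auto simp: Bax_def nth_append simp del: upt_Suc)

theorem theorem4: "isomorphic_to_subtree NewSch Bax"
proof (rule isomorphic_to_subtree_if_simulation)
  \<comment> \<open>Positivity of \<open>h\<close> gives \<open>2 \<le> h' + 1\<close>, so that
    \<open>(h' + 1, j)\<close> dominates \<open>(2, j)\<close>.\<close>
  let ?sim = "\<lambda>(h, k) (h', k'). 1 \<le> h \<and> h \<le> h' \<and> 1 \<le> k \<and> k \<le> (k' :: nat)"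
  \<comment> \<open>The shift skips the \<open>h' - h\<close> surplus children in the first Bax
    block; the last position \<open>h + k - 1\<close> lands on \<open>(h' + 1, k)\<close>, which
    exists since \<open>k \<le> k'\<close>.\<close>
  let ?g = "\<lambda>(h, k :: nat) (h', k' :: nat) i. if i < h then i else i - h + (h' :: nat)"
  show "?sim (root_label NewSch) (root_label Bax)"
    by (simp add: NewSch_def Bax_def)
  fix l m :: "nat \<times> nat" assume lm: "?sim l m"
  then show "inj_on (?g l m) {..<length (production NewSch l)}"
    by (auto simp: inj_on_def split: if_splits)
  fix i assume i: "i < length (production NewSch l)"
  with lm show "?g l m i < length (production Bax m)"
    by (auto simp: length_production_NewSch length_production_Bax split: prod.splits)
  from lm i show "?sim (production NewSch l ! i) (production Bax m ! ?g l m i)"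
    by (cases l; cases m)
      (auto simp: length_production_NewSch nth_production_NewSch nth_production_Bax
        split: if_splits)
qed

end
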